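(* Assume that the coefficients of the explicit exponential Runge--Kutta method described in the context may be written as linear combinations $$a_{ij}(H\mathcal{L})=\sum_{k=1}^{\ell_{ij}}\alpha^{(k)}_{ij}\,\varphi_{k}(c_i H\mathcal{L})\quad(2\le j<i\le s),\qquad b_{i}(H\mathcal{L})=\sum_{k=1}^{m_i}\beta^{(k)}_{i}\,\varphi_{k}(H\mathcal{L})\quad(2\le i\le s),$$ for some positive integers $\ell_{ij}$, $m_i$ and scalars $\alpha^{(k)}_{ij},\beta^{(k)}_i$. Define the polynomials in $\tau$ $$p_{n,i}(\tau)= \mathcal{N}(t_n, u_n)+\sum_{j=2}^{i-1} \Big(\sum_{k=1}^{\ell_{ij}}\frac{\alpha^{(k)}_{ij}}{c_i^{k} H^{k-1} (k-1)!}\tau^{k-1}\Big) D_{n,j},\qquad i=2,\ldots,s,$$ $$q_{n}(\tau) = \mathcal{N}(t_n, u_n)+\sum_{i=2}^{s} \Big(\sum_{k=1}^{m_i}\frac{\beta^{(k)}_{i}}{H^{k-1}(k-1)!}\tau^{k-1} \Big) D_{n,i}.$$ Then $U_{n,i}$ ($i=2,\ldots,s$) and $u_{n+1}$ are the exact solutions of the linear differential equations $$v_{n,i}'(\tau)=\mathcal{L}v_{n,i}(\tau)+p_{n,i}(\tau),\quad v_{n,i}(0)=u_n,\qquad i=2,\ldots,s,$$ $$v_n'(\tau)=\mathcal{L}v_n(\tau)+q_n(\tau),\quad v_n(0)=u_n,$$ at the times $\tau=c_iH$ and $\tau=H$, respectively; that is, $U_{n,i}=v_{n,i}(c_iH)$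 for $i=2,\ldots,s$ and $u_{n+1}=v_n(H)$.
   Context: Consider the initial value problem $u'(t)=F(t,u(t))=\mathcal{L}u(t)+\mathcal{N}(t,u(t))$, $u(t_0)=u_0$, with $\mathcal{L}\in\mathbb{R}^{d\times d}$ and $\mathcal{N}$ a (nonlinear) function with values in $\mathbb{R}^d$. Let $H>0$ be the step size and $t_{n+1}=t_n+H$. For $k\ge 1$, $$\varphi_k(z)=\int_0^1 e^{(1-\theta)z}\frac{\theta^{k-1}}{(k-1)!}\,d\theta,$$ and $\varphi_k$ of a matrix is defined by the same integral with the matrix exponential. An explicit $s$-stage exponential Runge--Kutta (ExpRK) method with nodes $c_1=0$, $c_2,\ldots,c_s$ (with $c_i\neq 0$ for $i\ge 2$) and coefficients $a_{ij}(H\mathcal{L})$, $b_i(H\mathcal{L})$ computes, from a given $u_n$ (with $U_{n,1}=u_n$), $$U_{n,i}=u_n+c_iH\varphi_1(c_iH\mathcal{L})F(t_n,u_n)+H\sum_{j=2}^{i-1}a_{ij}(H\mathcal{L})D_{n,j},\quad i=2,\ldots,s,$$ $$u_{n+1}=u_n+H\varphi_1(H\mathcal{L})F(t_n,u_n)+H\sum_{i=2}^{s}b_i(H\mathcal{L})D_{n,i},$$ where $D_{n,i}=\mathcal{N}(t_n+c_iH,U_{n,i})-\mathcal{N}(t_n,u_n)$ for $i=2,\ldots,s$. *)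

theory Defs
  imports "HOL-Analysis.Analysis"
begin

(* Multiplication on real^'d^'d is componentwise in HOL-Analysis, so powers and exp of a
   matrix have to be built from the matrix product ** instead of ^ and the library's exp. *)
definition matrix_power :: "real^'d^'d \<Rightarrow> nat \<Rightarrow> real^'d^'d" where
  "matrix_power A n = (((**) A) ^^ n) (mat 1)"

definition matrix_exp :: "real^'d^'d \<Rightarrow> real^'d^'d" where
  "matrix_exp A = (\<Sum>n. (1 / fact n) *\<^sub>R matrix_power A n)"

(* Meaningful for k >= 1 only. *)
definition matrix_phi :: "nat \<Rightarrow> real^'d^'d \<Rightarrow> real^'d^'d" where
  "matrix_phi k Z =
     integral {0..1} (\<lambda>\<theta>. (\<theta> ^ (k - 1) / fact (k - 1)) *\<^sub>R matrix_exp ((1 - \<theta>) *\<^sub>R Z))"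

definition ivp_rhs ::
  "real^'d^'d \<Rightarrow> (real \<Rightarrow> real^'d \<Rightarrow> real^'d) \<Rightarrow> real \<Rightarrow> real^'d \<Rightarrow> real^'d" where
  "ivp_rhs L N t u = L *v u + N t u"

(* The coefficients a i j and b i are matrix functions, evaluated at H L.  The stages are
   numbered from 1; exprk_stage .. 1 is the given value un. *)
function exprk_stage ::
  "real^'d^'d \<Rightarrow> (real \<Rightarrow> real^'d \<Rightarrow> real^'d) \<Rightarrow> real \<Rightarrow> (nat \<Rightarrow> real)
    \<Rightarrow> (nat \<Rightarrow> nat \<Rightarrow> real^'d^'d \<Rightarrow> real^'d^'d) \<Rightarrow> real \<Rightarrow> real^'d \<Rightarrow> nat \<Rightarrow> real^'d" where
  "exprk_stage L N H c a tn un i =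
     (if i \<le> 1 then un
      else un + (c i * H) *\<^sub>R (matrix_phi 1 ((c i * H) *\<^sub>R L) *v ivp_rhs L N tn un)
             + H *\<^sub>R (\<Sum>j\<in>{2..<i}. a i j (H *\<^sub>R L) *v
                 (N (tn + c j * H) (exprk_stage L N H c a tn un j) - N tn un)))"
  by pat_completeness auto
termination
  by (relation "Wellfounded.measure (\<lambda>(L, N, H, c, a, tn, un, i). i)") auto

declare exprk_stage.simps [simp del]

definition exprk_diff ::
  "real^'d^'d \<Rightarrow> (real \<Rightarrow> real^'d \<Rightarrow> real^'d) \<Rightarrow> real \<Rightarrow> (nat \<Rightarrow> real)
    \<Rightarrow> (nat \<Rightarrow> nat \<Rightarrow> real^'d^'d \<Rightarrow> real^'d^'d) \<Rightarrow> real \<Rightarrow> real^'d \<Rightarrow> nat \<Rightarrow> real^'d" where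
  "exprk_diff L N H c a tn un i =
     N (tn + c i * H) (exprk_stage L N H c a tn un i) - N tn un"

definition exprk_step ::
  "real^'d^'d \<Rightarrow> (real \<Rightarrow> real^'d \<Rightarrow> real^'d) \<Rightarrow> real \<Rightarrow> nat \<Rightarrow> (nat \<Rightarrow> real)
    \<Rightarrow> (nat \<Rightarrow> nat \<Rightarrow> real^'d^'d \<Rightarrow> real^'d^'d) \<Rightarrow> (nat \<Rightarrow> real^'d^'d \<Rightarrow> real^'d^'d)
    \<Rightarrow> real \<Rightarrow> real^'d \<Rightarrow> real^'d" where
  "exprk_step L N H s c a b tn un =
     un + H *\<^sub>R (matrix_phi 1 (H *\<^sub>R L) *v ivp_rhs L N tn un)
        + H *\<^sub>R (\<Sum>i=2..s. b i (H *\<^sub>R L) *v exprk_diff L N H c a tn un i)"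

definition stage_poly ::
  "real \<Rightarrow> (nat \<Rightarrow> real) \<Rightarrow> (nat \<Rightarrow> nat \<Rightarrow> nat) \<Rightarrow> (nat \<Rightarrow> nat \<Rightarrow> nat \<Rightarrow> real)
    \<Rightarrow> real^'d \<Rightarrow> (nat \<Rightarrow> real^'d) \<Rightarrow> nat \<Rightarrow> real \<Rightarrow> real^'d" where
  "stage_poly H c l \<alpha> Nn D i \<tau> =
     Nn + (\<Sum>j\<in>{2..<i}. (\<Sum>k=1..l i j.
             \<alpha> i j k / (c i ^ k * H ^ (k - 1) * fact (k - 1)) * \<tau> ^ (k - 1)) *\<^sub>R D j)"

definition step_poly ::
  "real \<Rightarrow> nat \<Rightarrow> (nat \<Rightarrow> nat) \<Rightarrow> (nat \<Rightarrow> nat \<Rightarrow> real)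
    \<Rightarrow> real^'d \<Rightarrow> (nat \<Rightarrow> real^'d) \<Rightarrow> real \<Rightarrow> real^'d" where
  "step_poly H s m \<beta> Nn D \<tau> =
     Nn + (\<Sum>i=2..s. (\<Sum>k=1..m i.
             \<beta> i k / (H ^ (k - 1) * fact (k - 1)) * \<tau> ^ (k - 1)) *\<^sub>R D i)"

definition solves_linear_ivp ::
  "real^'d^'d \<Rightarrow> (real \<Rightarrow> real^'d) \<Rightarrow> real^'d \<Rightarrow> real set \<Rightarrow> (real \<Rightarrow> real^'d) \<Rightarrow> bool" where
  "solves_linear_ivp L p x0 T v \<longleftrightarrow>
     v 0 = x0 \<and> (\<forall>\<tau>\<in>T. (v has_vector_derivative (L *v v \<tau> + p \<tau>)) (at \<tau> within T))"

(* "y is the value at time r of the exact solution": on every interval containing 0 and r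
   (r may be negative) there is a solution, it is unique there, and it has value y at r. *)
definition exact_solution_value ::
  "real^'d^'d \<Rightarrow> (real \<Rightarrow> real^'d) \<Rightarrow> real^'d \<Rightarrow> real \<Rightarrow> real^'d \<Rightarrow> bool" where
  "exact_solution_value L p x0 r y \<longleftrightarrow>
     (\<forall>T. is_interval T \<and> 0 \<in> T \<and> r \<in> T \<longrightarrow>
        (\<exists>v. solves_linear_ivp L p x0 T v \<and> v r = y \<and>
             (\<forall>w. solves_linear_ivp L p x0 T w \<longrightarrow> (\<forall>\<tau>\<in>T. w \<tau> = v \<tau>))))"

end

theory Submission
  imports Defs
begin

text \<open>
  The statement is the variation-of-constants formula combined with one shift. If
  \<open>v' = L v + p\<close> and \<open>v 0 = x0\<close>, then the difference \<open>v - x0\<close> vanishes at \<open>0\<close> and is driven by the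
  forcing \<open>p + L x0\<close>, so that
  \<open>v r = x0 + r \<integral>\<^sub>0\<^sup>1 exp ((1 - \<theta>) r L) (p (\<theta> r) + L x0) d\<theta>\<close>.
  A monomial \<open>\<tau> ^ (k - 1) / (k - 1)!\<close> in \<open>p\<close> therefore contributes exactly
  the factor \<open>r ^ k \<phi>\<^sub>k (r L)\<close>. The summand \<open>N (t n) (u n)\<close> of the forcing joins \<open>L x0\<close>
  (with \<open>x0 = u n\<close>) to form the right-hand side of the original problem at \<open>u n\<close>, and this
  constant vector is multiplied by \<open>r \<phi>\<^sub>1 (r L)\<close>, as in the method. The powers of \<open>c i\<close> and
  \<open>H\<close> in the denominators of the forcing polynomials are those that turn \<open>r ^ k\<close> into a single
  factor \<open>H\<close> (\<open>polynomial_forcing_exact_solution\<close>).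

  The formula is proved on the fixed interval \<open>[0, 1]\<close> by differentiating
  \<open>\<theta> \<mapsto> exp ((1 - \<theta>) r L) (v (\<theta> r) - x0)\<close> (\<open>ivp_value_formula\<close>); the rescaling of time treats
  negative \<open>r\<close> (negative nodes) together with positive ones. Since it determines each solution at
  each point, it gives uniqueness as well as the value. Existence for continuous forcing
  comes from the integrating factor \<open>exp (- \<tau> L)\<close> (\<open>linear_ivp_global_solution\<close>).
\<close>

section \<open>The matrix exponential as a one-parameter group\<close>

lemma bounded_bilinear_matrix_mult:
  "bounded_bilinear ((**) :: real^'d^'d \<Rightarrow> real^'d^'d \<Rightarrow> real^'d^'d)"
proof -
  have "bilinear ((**) :: real^'d^'d \<Rightarrow> real^'d^'d \<Rightarrow> real^'d^'d)"
    unfolding bilinear_def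
    by (auto intro!: linearI
        simp: matrix_matrix_mult_def vec_eq_iff sum.distrib sum_distrib_left algebra_simps)
  then show ?thesis by (simp add: bilinear_conv_bounded_bilinear)
qed

lemma bounded_bilinear_matrix_vector_mult:
  "bounded_bilinear ((*v) :: real^'d^'d \<Rightarrow> real^'d \<Rightarrow> real^'d)"
proof -
  have "bilinear ((*v) :: real^'d^'d \<Rightarrow> real^'d \<Rightarrow> real^'d)"
    unfolding bilinear_def
    by (auto intro!: linearI
        simp: matrix_vector_mult_def vec_eq_iff sum.distrib sum_distrib_left algebra_simps)
  then show ?thesis by (simp add: bilinear_conv_bounded_bilinear)
qed

interpretation mm: bounded_bilinear "(**) :: real^'d^'d \<Rightarrow> real^'d^'d \<Rightarrow> real^'d^'d"
  by (rule bounded_bilinear_matrix_mult)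

interpretation mv: bounded_bilinear "(*v) :: real^'d^'d \<Rightarrow> real^'d \<Rightarrow> real^'d"
  by (rule bounded_bilinear_matrix_vector_mult)

lemma matrix_power_Suc: "matrix_power A (Suc n) = A ** matrix_power A n"
  by (simp add: matrix_power_def)

lemma matrix_power_commute: "A ** matrix_power A n = matrix_power A n ** A"
proof (induction n)
  case 0
  show ?case by (simp add: matrix_power_def)
next
  case (Suc n)
  then show ?case by (metis matrix_power_Suc matrix_mul_assoc)
qed

lemma matrix_power_scaleR: "matrix_power (x *\<^sub>R A) n = x ^ n *\<^sub>R matrix_power A n"
proof (induction n)
  case 0
  show ?case by (simp add: matrix_power_def)
next
  case (Suc n)
  then show ?case by (simp add: matrix_power_Suc mm.scaleR_left mm.scaleR_right)
qed

lemma matrix_exp_summable: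
  fixes A :: "real^'d^'d"
  shows "summable (\<lambda>n. (1 / fact n) *\<^sub>R matrix_power A n)"
proof -
  obtain K where K: "0 \<le> K"
    "\<And>(A :: real^'d^'d) (B :: real^'d^'d). norm (A ** B) \<le> norm A * norm B * K"
    using mm.nonneg_bounded by metis
  \<comment> \<open>Bounded bilinearity stands in for submultiplicativity of the norm: the constant \<open>K\<close> only
    enlarges the ratio of the geometric bound, and the factorials still win.\<close>
  have power_bound: "norm (matrix_power A n) \<le> norm (mat 1 :: real^'d^'d) * (norm A * K) ^ n" for n
  proof (induction n)
    case 0
    show ?case by (simp add: matrix_power_def)
  next
    case (Suc n)
    have "norm (matrix_power A (Suc n)) \<le> norm A * norm (matrix_power A n) * K"
      unfolding matrix_power_Suc by (rule K)
    also have "\<dots> = (norm A * K) * norm (matrix_power A n)" by simp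
    also have "\<dots> \<le> (norm A * K) * (norm (mat 1 :: real^'d^'d) * (norm A * K) ^ n)"
      using Suc K(1) by (intro mult_left_mono) auto
    finally show ?case by (simp add: mult_ac)
  qed
  have "summable (\<lambda>n. norm (mat 1 :: real^'d^'d) * ((norm A * K) ^ n /\<^sub>R fact n))"
    by (intro summable_mult summable_exp_generic)
  then show ?thesis
  proof (rule summable_comparison_test'[where N = 0])
    fix n
    show "norm ((1 / fact n) *\<^sub>R matrix_power A n)
        \<le> norm (mat 1 :: real^'d^'d) * ((norm A * K) ^ n /\<^sub>R fact n)"
      using power_bound[of n] by (simp add: divide_simps)
  qed
qed

lemma matrix_exp_0: "matrix_exp (0 :: real^'d^'d) = mat 1"
proof -
  have "(\<lambda>n. (1 / fact n) *\<^sub>R matrix_power (0 :: real^'d^'d) n)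
      = (\<lambda>n. if n = 0 then mat 1 else 0)"
    by (auto simp: fun_eq_iff gr0_conv_Suc matrix_power_Suc mm.zero_left)
      (auto simp: matrix_power_def)
  then show ?thesis
    using sums_single[of 0 "\<lambda>_. mat 1 :: real^'d^'d"]
    by (simp add: matrix_exp_def sums_iff cong: if_cong)
qed

lemma matrix_exp_commute: "A ** matrix_exp A = matrix_exp A ** A"
proof -
  have "A ** matrix_exp A = (\<Sum>n. A ** ((1 / fact n) *\<^sub>R matrix_power A n))"
    unfolding matrix_exp_def
    by (rule bounded_linear.suminf[OF mm.bounded_linear_right matrix_exp_summable])
  also have "\<dots> = (\<Sum>n. ((1 / fact n) *\<^sub>R matrix_power A n) ** A)"
    by (simp add: mm.scaleR_left mm.scaleR_right matrix_power_commute)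
  also have "\<dots> = matrix_exp A ** A"
    unfolding matrix_exp_def
    by (rule bounded_linear.suminf[OF mm.bounded_linear_left matrix_exp_summable, symmetric])
  finally show ?thesis .
qed

lemma matrix_exp_scaleR_commute: "L ** matrix_exp (x *\<^sub>R L) = matrix_exp (x *\<^sub>R L) ** L"
proof (cases "x = 0")
  case True
  then show ?thesis by (simp add: matrix_exp_0)
next
  case False
  then show ?thesis
    using matrix_exp_commute[of "x *\<^sub>R L"] by (simp add: mm.scaleR_left mm.scaleR_right)
qed

text \<open>Against a fixed basis matrix the exponential series becomes an everywhere convergent real power
  series in \<open>x\<close>, which may be differentiated termwise.\<close>

lemma matrix_exp_has_vector_derivative:
  fixes L :: "real^'d^'d"
  shows "((\<lambda>x. matrix_exp (x *\<^sub>R L)) has_vector_derivative L ** matrix_exp (x *\<^sub>R L)) (at x within S)"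
proof -
  have component: "((\<lambda>x. matrix_exp (x *\<^sub>R L) \<bullet> B) has_field_derivative
      (L ** matrix_exp (x *\<^sub>R L)) \<bullet> B) (at x)" for B
  proof -
    define a where "a n = (matrix_power L n \<bullet> B) / fact n" for n
    have a_eq: "((1 / fact n) *\<^sub>R matrix_power (y *\<^sub>R L) n) \<bullet> B = a n * y ^ n" for n y
      by (simp add: a_def matrix_power_scaleR)
    have inner: "(\<lambda>n. a n * y ^ n) sums (matrix_exp (y *\<^sub>R L) \<bullet> B)" for y
      using bounded_linear.sums[OF bounded_linear_inner_left
          summable_sums[OF matrix_exp_summable[of "y *\<^sub>R L"]], of B]
      unfolding a_eq by (simp add: matrix_exp_def)
    have diffs_eq: "(L ** ((1 / fact n) *\<^sub>R matrix_power (x *\<^sub>R L) n)) \<bullet> B = diffs a n * x ^ n" for n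
      by (simp add: a_def diffs_def matrix_power_scaleR mm.scaleR_right matrix_power_Suc divide_simps
          del: of_nat_Suc)
    have "(\<lambda>n. diffs a n * x ^ n) sums ((L ** matrix_exp (x *\<^sub>R L)) \<bullet> B)"
      using bounded_linear.sums[OF bounded_linear_inner_left
          bounded_linear.sums[OF mm.bounded_linear_right
            summable_sums[OF matrix_exp_summable[of "x *\<^sub>R L"]]], of L B]
      unfolding diffs_eq by (simp add: matrix_exp_def)
    moreover have "((\<lambda>x. \<Sum>n. a n * x ^ n) has_field_derivative (\<Sum>n. diffs a n * x ^ n)) (at x)"
      by (rule termdiffs_strong_converges_everywhere) (use inner sums_summable in blast)
    ultimately show ?thesis
      using inner by (simp add: sums_iff)
  qed
  have "((\<lambda>x. matrix_exp (x *\<^sub>R L)) has_vector_derivative L ** matrix_exp (x *\<^sub>R L)) (at x)"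
    unfolding has_vector_derivative_def
    using component
    by (subst has_derivative_componentwise_within) (auto simp: has_field_derivative_def mult_commute_abs)
  then show ?thesis by (rule has_vector_derivative_at_within)
qed

lemma matrix_exp_affine_has_vector_derivative:
  fixes L :: "real^'d^'d" and p q :: real
  shows "((\<lambda>x. matrix_exp ((p + x * q) *\<^sub>R L)) has_vector_derivative
    q *\<^sub>R (L ** matrix_exp ((p + x * q) *\<^sub>R L))) (at x within S)"
proof -
  have "((\<lambda>x. p + x * q) has_vector_derivative q) (at x within S)"
    by (auto intro!: derivative_eq_intros)
  from vector_diff_chain_within[OF this matrix_exp_has_vector_derivative[of L]]
  show ?thesis by (simp add: o_def)
qed

lemma continuous_on_matrix_exp_affine:
  "continuous_on S (\<lambda>x. matrix_exp ((p + x * q) *\<^sub>R (L :: real^'d^'d)))"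
  unfolding continuous_on_eq_continuous_within
  using has_vector_derivative_continuous[OF matrix_exp_affine_has_vector_derivative] by blast

text \<open>The product is constant in \<open>x\<close>: the two terms of its derivative cancel because \<open>L\<close> commutes
  with \<open>exp (x L)\<close>.\<close>

lemma matrix_exp_mult_minus: "matrix_exp (x *\<^sub>R L) ** matrix_exp ((- x) *\<^sub>R L) = mat 1"
  for L :: "real^'d^'d"
proof -
  let ?P = "\<lambda>x. matrix_exp (x *\<^sub>R L) ** matrix_exp ((- x) *\<^sub>R L)"
  have "(?P has_vector_derivative 0) (at y)" for y
  proof -
    have minus: "((\<lambda>x. matrix_exp ((- x) *\<^sub>R L)) has_vector_derivative
        - (L ** matrix_exp ((- y) *\<^sub>R L))) (at y)"
      using matrix_exp_affine_has_vector_derivative[of 0 "-1" L y UNIV] by simp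
    have "matrix_exp (y *\<^sub>R L) ** - (L ** matrix_exp ((- y) *\<^sub>R L))
        + L ** matrix_exp (y *\<^sub>R L) ** matrix_exp ((- y) *\<^sub>R L) = 0"
      by (simp add: mm.minus_right matrix_mul_assoc matrix_exp_scaleR_commute[of L y]
          del: scaleR_minus_left)
    with mm.has_vector_derivative[OF matrix_exp_has_vector_derivative[of L] minus]
    show ?thesis by (simp only:)
  qed
  then have "\<exists>C. \<forall>x\<in>UNIV. ?P x = C"
    by (intro has_derivative_zero_constant) (auto simp: has_vector_derivative_def)
  then obtain C where "\<And>x. ?P x = C" by blast
  from this[of x] this[of 0] have "?P x = ?P 0" by (simp only:)
  then show ?thesis by (simp add: matrix_exp_0)
qed

section \<open>Linear initial value problems with continuous forcing\<close>

text \<open>Integrating factor: with an antiderivative \<open>G\<close> of \<open>exp (- \<tau> L) (p \<tau>)\<close>, the solution is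
  \<open>exp (\<tau> L) (x0 + G \<tau> - G 0)\<close>.\<close>

lemma linear_ivp_global_solution:
  fixes L :: "real^'d^'d"
  assumes "continuous_on UNIV p"
  obtains v where "solves_linear_ivp L p x0 UNIV v"
proof -
  let ?E = "\<lambda>x. matrix_exp (x *\<^sub>R L)"
  have "continuous_on UNIV (\<lambda>x. ?E (- x) *v p x)"
    using continuous_on_matrix_exp_affine[of UNIV 0 "-1" L] assms
    by (intro mv.continuous_on) auto
  then have "\<exists>G. \<forall>x :: real. - \<infinity> < ereal x \<longrightarrow> ereal x < \<infinity> \<longrightarrow>
      (G has_vector_derivative ?E (- x) *v p x) (at x)"
    by (intro einterval_antiderivative) (auto simp: continuous_on_eq_continuous_at)
  then obtain G where G: "\<And>x. (G has_vector_derivative ?E (- x) *v p x) (at x)"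
    by auto
  define v where "v x = ?E x *v (x0 + (G x - G 0))" for x
  have "(v has_vector_derivative L *v v x + p x) (at x)" for x
  proof -
    have "((\<lambda>x. x0 + (G x - G 0)) has_vector_derivative ?E (- x) *v p x) (at x)"
      using G by (auto intro!: derivative_eq_intros)
    from mv.has_vector_derivative[OF matrix_exp_has_vector_derivative this]
    have "(v has_vector_derivative ?E x *v (?E (- x) *v p x)
        + (L ** ?E x) *v (x0 + (G x - G 0))) (at x)"
      unfolding v_def .
    moreover have "?E x *v (?E (- x) *v p x) = p x"
      by (simp add: matrix_vector_mul_assoc matrix_exp_mult_minus del: scaleR_minus_left)
    moreover have "(L ** ?E x) *v (x0 + (G x - G 0)) = L *v v x"
      by (simp add: v_def matrix_vector_mul_assoc)
    ultimately show ?thesis by (simp add: add.commute)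
  qed
  moreover have "v 0 = x0" by (simp add: v_def matrix_exp_0)
  ultimately show ?thesis
    by (intro that[of v]) (simp add: solves_linear_ivp_def)
qed

text \<open>Variation of constants for the difference \<open>w - x0\<close>. Subtracting the initial value removes
  the term \<open>exp (r L) x0\<close> and moves \<open>L x0\<close> into the integrand, where \<open>\<phi>\<^sub>1\<close> picks it up.\<close>

lemma ivp_value_formula:
  fixes L :: "real^'d^'d"
  assumes sol: "solves_linear_ivp L p x0 T w"
    and T: "is_interval T" "0 \<in> T" "r \<in> T"
  shows "((\<lambda>\<theta>. r *\<^sub>R (matrix_exp ((1 - \<theta>) *\<^sub>R (r *\<^sub>R L)) *v (p (\<theta> * r) + L *v x0)))
           has_integral (w r - x0)) {0..1}"
proof -
  let ?E = "\<lambda>\<theta>. matrix_exp ((r + \<theta> * (- r)) *\<^sub>R L)"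
  let ?f = "\<lambda>\<theta>. ?E \<theta> *v (w (\<theta> * r) - x0)"
  have seg: "\<theta> * r \<in> T" if "\<theta> \<in> {0..1}" for \<theta>
  proof -
    have "convex T" using T(1) by (simp add: is_interval_convex)
    from convexD[OF this T(2,3), of "1 - \<theta>" \<theta>] that show ?thesis by simp
  qed
  have E_eq: "?E \<theta> = matrix_exp ((1 - \<theta>) *\<^sub>R (r *\<^sub>R L))" for \<theta>
    by (simp add: algebra_simps)
  have "(?f has_vector_derivative r *\<^sub>R (?E \<theta> *v (p (\<theta> * r) + L *v x0))) (at \<theta> within {0..1})"
    if \<theta>: "\<theta> \<in> {0..1}" for \<theta>
  proof -
    have "(w has_vector_derivative L *v w (\<theta> * r) + p (\<theta> * r)) (at (\<theta> * r) within T)"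
      using sol seg[OF \<theta>] by (simp add: solves_linear_ivp_def)
    then have "(w has_vector_derivative L *v w (\<theta> * r) + p (\<theta> * r))
        (at (\<theta> * r) within (\<lambda>\<theta>. \<theta> * r) ` {0..1})"
      by (rule has_vector_derivative_within_subset) (use seg in auto)
    moreover have "((\<lambda>\<theta>. \<theta> * r) has_vector_derivative r) (at \<theta> within {0..1})"
      by (auto intro!: derivative_eq_intros)
    ultimately have "((w \<circ> (\<lambda>\<theta>. \<theta> * r)) has_vector_derivative
        r *\<^sub>R (L *v w (\<theta> * r) + p (\<theta> * r))) (at \<theta> within {0..1})"
      using vector_diff_chain_within by blast
    then have "((\<lambda>\<theta>. w (\<theta> * r) - x0) has_vector_derivative
        r *\<^sub>R (L *v w (\<theta> * r) + p (\<theta> * r))) (at \<theta> within {0..1})"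
      by (auto simp: o_def intro!: derivative_eq_intros)
    from mv.has_vector_derivative[OF matrix_exp_affine_has_vector_derivative this]
    have "(?f has_vector_derivative ?E \<theta> *v (r *\<^sub>R (L *v w (\<theta> * r) + p (\<theta> * r)))
        + ((- r) *\<^sub>R (L ** ?E \<theta>)) *v (w (\<theta> * r) - x0)) (at \<theta> within {0..1})" .
    moreover have "?E \<theta> *v (r *\<^sub>R (L *v w (\<theta> * r) + p (\<theta> * r)))
        + ((- r) *\<^sub>R (L ** ?E \<theta>)) *v (w (\<theta> * r) - x0) = r *\<^sub>R (?E \<theta> *v (p (\<theta> * r) + L *v x0))"
    proof -
      have "((- r) *\<^sub>R (L ** ?E \<theta>)) *v (w (\<theta> * r) - x0)
          = (- r) *\<^sub>R (?E \<theta> *v (L *v (w (\<theta> * r) - x0)))"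
        by (simp only: matrix_exp_scaleR_commute mv.scaleR_left matrix_vector_mul_assoc)
      then show ?thesis
        by (simp only: mv.scaleR_right mv.add_right mv.diff_right scaleR_minus_left
            scaleR_add_right scaleR_diff_right) simp
    qed
    ultimately show ?thesis by simp
  qed
  then have "((\<lambda>\<theta>. r *\<^sub>R (?E \<theta> *v (p (\<theta> * r) + L *v x0))) has_integral (?f 1 - ?f 0)) {0..1}"
    by (intro fundamental_theorem_of_calculus) auto
  moreover have "?f 1 - ?f 0 = w r - x0"
    using sol by (simp add: solves_linear_ivp_def matrix_exp_0)
  ultimately show ?thesis unfolding E_eq by simp
qed

text \<open>The value formula depends on the forcing and the initial value alone. At \<open>r\<close> it therefore
  identifies \<open>y\<close>, and at every other point of the interval it forces two solutions to agree.\<close>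

lemma exact_solution_valueI:
  fixes L :: "real^'d^'d"
  assumes "continuous_on UNIV p"
    and "((\<lambda>\<theta>. r *\<^sub>R (matrix_exp ((1 - \<theta>) *\<^sub>R (r *\<^sub>R L)) *v (p (\<theta> * r) + L *v x0)))
           has_integral (y - x0)) {0..1}"
  shows "exact_solution_value L p x0 r y"
  unfolding exact_solution_value_def
proof (intro allI impI, elim conjE)
  fix T :: "real set"
  assume T: "is_interval T" "0 \<in> T" "r \<in> T"
  obtain v where "solves_linear_ivp L p x0 UNIV v"
    using linear_ivp_global_solution[OF assms(1)] .
  then have v: "solves_linear_ivp L p x0 T v"
    by (auto simp: solves_linear_ivp_def intro: has_vector_derivative_at_within)
  have "v r - x0 = y - x0"
    using ivp_value_formula[OF v T] assms(2) by (rule has_integral_unique)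
  moreover have "w \<tau> = v \<tau>" if "solves_linear_ivp L p x0 T w" "\<tau> \<in> T" for w \<tau>
  proof -
    have "w \<tau> - x0 = v \<tau> - x0"
      using ivp_value_formula[OF that(1) T(1,2) that(2)] ivp_value_formula[OF v T(1,2) that(2)]
      by (rule has_integral_unique)
    then show ?thesis by simp
  qed
  ultimately show "\<exists>v. solves_linear_ivp L p x0 T v \<and> v r = y \<and>
      (\<forall>w. solves_linear_ivp L p x0 T w \<longrightarrow> (\<forall>\<tau>\<in>T. w \<tau> = v \<tau>))"
    using v by auto
qed

section \<open>Polynomial forcing and the \<phi>-functions\<close>

lemma matrix_phi_mult_vector_has_integral:
  "((\<lambda>\<theta>. (\<theta> ^ (k - 1) / fact (k - 1)) *\<^sub>R (matrix_exp ((1 - \<theta>) *\<^sub>R Z) *v x))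
      has_integral matrix_phi k Z *v x) {0..1}"
proof -
  have "continuous_on {0..1} (\<lambda>\<theta>. matrix_exp ((1 - \<theta>) *\<^sub>R Z))"
    using continuous_on_matrix_exp_affine[of "{0..1}" 1 "-1" Z] by simp
  then have "((\<lambda>\<theta>. (\<theta> ^ (k - 1) / fact (k - 1)) *\<^sub>R matrix_exp ((1 - \<theta>) *\<^sub>R Z))
      has_integral matrix_phi k Z) {0..1}"
    unfolding matrix_phi_def
    by (intro integrable_integral integrable_continuous_interval continuous_intros) auto
  from has_integral_linear[OF this mv.bounded_linear_left[of x]]
  show ?thesis by (simp add: o_def mv.scaleR_left)
qed

text \<open>The common form of a stage and of the final update. Inserting the polynomial into the value
  formula leaves one integral per monomial, and that integral is the definition of \<open>\<phi>\<^sub>k\<close>. The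
  coefficients \<open>\<gamma>\<close> are arbitrary: the stages use \<open>r = c i * H\<close> with
  \<open>\<gamma> = \<alpha> / (c i ^ k * H ^ (k - 1))\<close>, the update uses \<open>r = H\<close> with \<open>\<gamma> = \<beta> / H ^ (k - 1)\<close>.\<close>

lemma polynomial_forcing_exact_solution:
  fixes L :: "real^'d^'d" and D :: "'j \<Rightarrow> real^'d"
  assumes p: "\<And>\<tau>. p \<tau> = f0 + (\<Sum>j\<in>J. (\<Sum>k=1..K j. \<gamma> j k / fact (k - 1) * \<tau> ^ (k - 1)) *\<^sub>R D j)"
  shows "exact_solution_value L p x0 r
    (x0 + r *\<^sub>R (matrix_phi 1 (r *\<^sub>R L) *v (L *v x0 + f0))
        + (\<Sum>j\<in>J. (\<Sum>k=1..K j. (\<gamma> j k * r ^ k) *\<^sub>R matrix_phi k (r *\<^sub>R L)) *v D j))"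
proof (rule exact_solution_valueI)
  show "continuous_on UNIV p"
    unfolding p by (intro continuous_intros)
next
  let ?E = "\<lambda>\<theta>. matrix_exp ((1 - \<theta>) *\<^sub>R (r *\<^sub>R L))"
  let ?g = "\<lambda>j k \<theta>. (\<theta> ^ (k - 1) / fact (k - 1)) *\<^sub>R (?E \<theta> *v D j)"
  let ?y = "r *\<^sub>R (matrix_phi 1 (r *\<^sub>R L) *v (L *v x0 + f0))
      + (\<Sum>j\<in>J. \<Sum>k=1..K j. (\<gamma> j k * r ^ k) *\<^sub>R (matrix_phi k (r *\<^sub>R L) *v D j))"
  have const: "((\<lambda>\<theta>. ?E \<theta> *v (L *v x0 + f0)) has_integral
      matrix_phi 1 (r *\<^sub>R L) *v (L *v x0 + f0)) {0..1}"
    using matrix_phi_mult_vector_has_integral[of 1 "r *\<^sub>R L"] by simp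
  have integral: "((\<lambda>\<theta>. r *\<^sub>R (?E \<theta> *v (L *v x0 + f0))
      + (\<Sum>j\<in>J. \<Sum>k=1..K j. (\<gamma> j k * r ^ k) *\<^sub>R ?g j k \<theta>)) has_integral ?y) {0..1}"
  proof (cases "finite J")
    case True
    then show ?thesis
      by (intro has_integral_add has_integral_sum has_integral_cmul const
          matrix_phi_mult_vector_has_integral) auto
  next
    case False
    then show ?thesis
      using has_integral_cmul[OF const, of r] by simp
  qed
  \<comment> \<open>The time interval supplies one factor \<open>r\<close> and \<open>(\<theta> r) ^ (k - 1)\<close> the remaining ones; since
    \<open>k \<ge> 1\<close> they make up \<open>r ^ k\<close>.\<close>
  have integrand: "r *\<^sub>R (?E \<theta> *v (p (\<theta> * r) + L *v x0))
      = r *\<^sub>R (?E \<theta> *v (L *v x0 + f0)) + (\<Sum>j\<in>J. \<Sum>k=1..K j. (\<gamma> j k * r ^ k) *\<^sub>R ?g j k \<theta>)" for \<theta>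
  proof -
    have weight: "r * (\<gamma> j k / fact (k - 1) * (\<theta> * r) ^ (k - 1)) = \<gamma> j k * r ^ k * (\<theta> ^ (k - 1) / fact (k - 1))"
      if "k \<in> {1..K j}" for j k
      using that by (cases k) (auto simp: power_mult_distrib)
    have "r *\<^sub>R (?E \<theta> *v ((\<Sum>k=1..K j. \<gamma> j k / fact (k - 1) * (\<theta> * r) ^ (k - 1)) *\<^sub>R D j))
        = (\<Sum>k=1..K j. (\<gamma> j k * r ^ k) *\<^sub>R ?g j k \<theta>)" for j
      by (simp only: mv.scaleR_right scaleR_scaleR sum_distrib_left flip: scaleR_sum_left)
        (simp only: weight cong: sum.cong)
    then show ?thesis
      unfolding p by (simp add: mv.add_right mv.sum_right scaleR_sum_right scaleR_add_right)
  qed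
  show "((\<lambda>\<theta>. r *\<^sub>R (?E \<theta> *v (p (\<theta> * r) + L *v x0))) has_integral
      (x0 + r *\<^sub>R (matrix_phi 1 (r *\<^sub>R L) *v (L *v x0 + f0))
        + (\<Sum>j\<in>J. (\<Sum>k=1..K j. (\<gamma> j k * r ^ k) *\<^sub>R matrix_phi k (r *\<^sub>R L)) *v D j) - x0)) {0..1}"
    using integral unfolding integrand by (simp add: mv.sum_left mv.scaleR_left)
qed

section \<open>The stages and the update as exact solutions\<close>

theorem theorem3p1:
  fixes L :: "real^'d^'d"
    and N :: "real \<Rightarrow> real^'d \<Rightarrow> real^'d"
    and H :: real
    and s :: nat
    and c :: "nat \<Rightarrow> real"
    and a :: "nat \<Rightarrow> nat \<Rightarrow> real^'d^'d \<Rightarrow> real^'d^'d"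
    and b :: "nat \<Rightarrow> real^'d^'d \<Rightarrow> real^'d^'d"
    and l :: "nat \<Rightarrow> nat \<Rightarrow> nat"
    and m :: "nat \<Rightarrow> nat"
    and \<alpha> :: "nat \<Rightarrow> nat \<Rightarrow> nat \<Rightarrow> real"
    and \<beta> :: "nat \<Rightarrow> nat \<Rightarrow> real"
    and t :: "nat \<Rightarrow> real"
    and u :: "nat \<Rightarrow> real^'d"
    and t0 :: real and u0 :: "real^'d"
  assumes "H > 0"
    and "s \<ge> 1"
    and "c 1 = 0"
    and "\<And>i. i \<in> {2..s} \<Longrightarrow> c i \<noteq> 0"
    and "\<And>i j. 2 \<le> j \<Longrightarrow> j < i \<Longrightarrow> i \<le> s \<Longrightarrow> l i j \<ge> 1"
    and "\<And>i. i \<in> {2..s} \<Longrightarrow> m i \<ge> 1"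
    and "\<And>i j. 2 \<le> j \<Longrightarrow> j < i \<Longrightarrow> i \<le> s \<Longrightarrow>
           a i j (H *\<^sub>R L) = (\<Sum>k=1..l i j. \<alpha> i j k *\<^sub>R matrix_phi k ((c i * H) *\<^sub>R L))"
    and "\<And>i. i \<in> {2..s} \<Longrightarrow>
           b i (H *\<^sub>R L) = (\<Sum>k=1..m i. \<beta> i k *\<^sub>R matrix_phi k (H *\<^sub>R L))"
    and "\<And>n. t (Suc n) = t n + H"
    and "t 0 = t0" and "u 0 = u0"
    and "\<And>n. u (Suc n) = exprk_step L N H s c a b (t n) (u n)"
  shows "(\<forall>i\<in>{2..s}.
            exact_solution_value L
              (stage_poly H c l \<alpha> (N (t n) (u n)) (exprk_diff L N H c a (t n) (u n)) i)
              (u n) (c i * H) (exprk_stage L N H c a (t n) (u n) i)) \<and>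
         exact_solution_value L
           (step_poly H s m \<beta> (N (t n) (u n)) (exprk_diff L N H c a (t n) (u n)))
           (u n) H (u (Suc n))"
proof (intro conjI ballI)
  fix i assume i: "i \<in> {2..s}"
  let ?D = "exprk_diff L N H c a (t n) (u n)"
  let ?\<gamma> = "\<lambda>j k. \<alpha> i j k / (c i ^ k * H ^ (k - 1))"
  have nz: "c i \<noteq> 0" "H \<noteq> 0" using assms(1,4) i by auto
  have "exact_solution_value L (stage_poly H c l \<alpha> (N (t n) (u n)) ?D i) (u n) (c i * H)
    (u n + (c i * H) *\<^sub>R (matrix_phi 1 ((c i * H) *\<^sub>R L) *v (L *v u n + N (t n) (u n)))
      + (\<Sum>j\<in>{2..<i}. (\<Sum>k=1..l i j. (?\<gamma> j k * (c i * H) ^ k) *\<^sub>R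
            matrix_phi k ((c i * H) *\<^sub>R L)) *v ?D j))"
    by (rule polynomial_forcing_exact_solution) (simp add: stage_poly_def mult.assoc)
  moreover have "(\<Sum>k=1..l i j. (?\<gamma> j k * (c i * H) ^ k) *\<^sub>R matrix_phi k ((c i * H) *\<^sub>R L))
      = H *\<^sub>R a i j (H *\<^sub>R L)" if "j \<in> {2..<i}" for j
  proof -
    have "?\<gamma> j k * (c i * H) ^ k = H * \<alpha> i j k" if "k \<in> {1..l i j}" for k
      using that nz by (cases k) (auto simp: power_mult_distrib)
    then show ?thesis
      using assms(7)[of j i] that i by (simp add: scaleR_sum_right)
  qed
  ultimately show "exact_solution_value L (stage_poly H c l \<alpha> (N (t n) (u n)) ?D i) (u n) (c i * H)
      (exprk_stage L N H c a (t n) (u n) i)"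
    using i by (simp add: exprk_stage.simps[of _ _ _ _ _ _ _ i] exprk_diff_def ivp_rhs_def
        mv.scaleR_left scaleR_sum_right)
next
  let ?D = "exprk_diff L N H c a (t n) (u n)"
  let ?\<gamma> = "\<lambda>i k. \<beta> i k / H ^ (k - 1)"
  have "exact_solution_value L (step_poly H s m \<beta> (N (t n) (u n)) ?D) (u n) H
    (u n + H *\<^sub>R (matrix_phi 1 (H *\<^sub>R L) *v (L *v u n + N (t n) (u n)))
      + (\<Sum>i=2..s. (\<Sum>k=1..m i. (?\<gamma> i k * H ^ k) *\<^sub>R matrix_phi k (H *\<^sub>R L)) *v ?D i))"
    by (rule polynomial_forcing_exact_solution) (simp add: step_poly_def)
  moreover have "(\<Sum>k=1..m i. (?\<gamma> i k * H ^ k) *\<^sub>R matrix_phi k (H *\<^sub>R L)) = H *\<^sub>R b i (H *\<^sub>R L)"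
    if "i \<in> {2..s}" for i
  proof -
    have "?\<gamma> i k * H ^ k = H * \<beta> i k" if "k \<in> {1..m i}" for k
      using that assms(1) by (cases k) auto
    then show ?thesis
      using assms(8)[OF that] by (simp add: scaleR_sum_right)
  qed
  ultimately show "exact_solution_value L (step_poly H s m \<beta> (N (t n) (u n)) ?D) (u n) H (u (Suc n))"
    by (simp add: assms(12) exprk_step_def ivp_rhs_def mv.scaleR_left scaleR_sum_right)
qed

end
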